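(* Let $I\subset[n+1]=\{1,\dots,n+1\}$ be a subset of cardinality $2k$ and let $x\in\mathrm{Perm}_I$. For each $\alpha\in\mathrm{Alt}_I$, $$\mathcal{C}^\alpha_x=\begin{cases} f_I([x,\alpha]), & \text{if } x\preceq\alpha,\\ 0,&\text{otherwise.}\end{cases}$$
   Context: $\mathrm{Perm}_I$ is the set of permutations of $I$, written $x=(x_1x_2/\cdots/x_{2k-1}x_{2k})$ in one-line notation grouped in blocks of length two; $\mathrm{Alt}_I$ is the set of alternating ones, $x_1<x_2>x_3<x_4>\cdots<x_{2k}$. $\mathbb{Q}\langle\mathrm{Perm}_I\rangle$ is the $\mathbb{Q}$-vector space with basis $\mathrm{Perm}_I$, and $M_I$ is its subspace generated, for all $x\in\mathrm{Perm}_I$ (entries not displayed unchanged), by (1) $(x_1\cdots/x_{2i-1}x_{2i}/\cdots x_{2k})+(x_1\cdots/x_{2i}x_{2i-1}/\cdots x_{2k})$ for $1\le i\le k$; (2) for $1\le i\le k-1$, $(x_1\cdots/x_{2i-1}x_{2i}/x_{2i+1}x_{2i+2}/\cdots x_{2k})-(x_1\cdots/x_{2i-1}x_{2i+1}/x_{2i}x_{2i+2}/\cdots x_{2k})+(x_1\cdots/x_{2i-1}x_{2i+2}/x_{2i}x_{2i+1}/\cdots x_{2k})+(x_1\cdots/x_{2i}x_{2i+1}/x_{2i-1}x_{2i+2}/\cdots x_{2k})-(x_1\cdots/x_{2i}x_{2i+2}/x_{2i-1}x_{2i+1}/\cdots x_{2k})+(x_1\cdots/x_{2i+1}x_{2i+2}/x_{2i-1}x_{2i}/\cdots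 x_{2k})$. The classes of the elements of $\mathrm{Alt}_I$ form a $\mathbb{Q}$-basis of $\mathbb{Q}\langle\mathrm{Perm}_I\rangle/M_I$, and $\mathcal{C}^\alpha_x\in\mathbb{Q}$ is defined by $x=\sum_{\alpha\in\mathrm{Alt}_I}\mathcal{C}^\alpha_x\,\alpha$ in this quotient. For $x\in\mathrm{Perm}_I$ let $\Sigma^x_i=\{x_i\}$ for $i=1,2$ and $\Sigma^x_i=\{x_1,\dots,x_{2\lfloor(i-1)/2\rfloor},x_i\}$ for $i\ge3$; let $\Delta_x=\{\Sigma^x_1,\Sigma^x_2\}\star\cdots\star\{\Sigma^x_{2k-1},\Sigma^x_{2k}\}$ (simplicial join, so a facet chooses one vertex from each pair), and $\varphi_I(x)=\{\Sigma^x_1,\Sigma^x_3,\dots,\Sigma^x_{2k-1}\}$. $\mathfrak{S}_{2k}$ acts on positions by $(\sigma\cdot x)_i=x_{\sigma(i)}$. $\mathfrak{S}_{2k}^{\mathrm{even}}$ is the subgroup of products $\sigma_1\cdots\sigma_k$ with $\sigma_i\in\mathfrak{S}_{\{2i-1,2i\}}$, and $\mathfrak{S}_{2k}^{\mathrm{odd}}$ the subgroup of products $\sigma_1\cdots\sigma_{k-1}$ with $\sigma_i\in\mathfrak{S}_{\{2i,2i+1\}}$. If $\varphi_I(\alpha)$ is a face of $\Delta_x$, there are unique $\tau_{\alpha,x}\in\mathfrak{S}_{2k}^{\mathrm{even}}$ and $\sigma_{\alpha,x}\in\mathfrak{S}_{2k}^{\mathrm{odd}}$ with $\tau_{\alpha,x}\cdot(\sigma_{\alpha,x}\cdot\alpha)=x$.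 For $x\in\mathrm{Perm}_I$ and $\alpha\in\mathrm{Alt}_I$ with $x\ne\alpha$, write $x\lessdot\alpha$ if $\varphi_I(\alpha)$ is a face of $\Delta_x$. Let $\preceq$ be the partial order on $\mathrm{Perm}_I$ that is the reflexive-transitive closure of $\lessdot$. The integer-valued function $f_I$ on intervals $[x,\alpha]$ (for $x\preceq\alpha$), an element of the incidence algebra of $(\mathrm{Perm}_I,\preceq)$ over $\mathbb{Z}$, is defined inductively by $$f_I([x,\alpha])=\begin{cases}-1,&\text{if }\alpha=x\notin\mathrm{Alt}_I,\\ \delta_{\alpha,x},&\text{if }x\in\mathrm{Alt}_I,\\ -\displaystyle\sum_{\beta:\ x\preceq\beta\lessdot\alpha}\mathrm{sgn}(\tau_{\alpha,\beta})\,f_I([x,\beta]),&\text{otherwise.}\end{cases}$$ In the sum, $\beta=x$ is included when $x\lessdot\alpha$. *)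

theory Defs
  imports
    "HOL-Combinatorics.Combinatorics"
    "HOL-Library.Poly_Mapping"
begin

text \<open>
  A permutation \<open>x = (x\<^sub>1x\<^sub>2/\<dots>/x\<^sub>2\<^sub>k\<^sub>-\<^sub>1x\<^sub>2\<^sub>k)\<close> of a finite set \<open>I\<close> of cardinality \<open>2k\<close> is the list of its
  entries.  Lists are indexed from 0, so the entry \<open>x\<^sub>i\<close> of the mathematical text is \<open>x ! (i - 1)\<close>,
  and the blocks occupy the positions \<open>{2j, 2j+1}\<close> with \<open>j < k\<close>.
\<close>

abbreviation Perm :: "nat set \<Rightarrow> nat list set"
  where "Perm I \<equiv> permutations_of_set I"

definition alternating :: "nat list \<Rightarrow> bool"
  where "alternating x \<longleftrightarrow>
    (\<forall>i. Suc i < length x \<longrightarrow> (if even i then x ! i < x ! Suc i else x ! i > x ! Suc i))"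

definition Alt :: "nat set \<Rightarrow> nat list set"
  where "Alt I = {x \<in> Perm I. alternating x}"


subsection \<open>The relations and the structure constants\<close>

text \<open>
  The free rational vector space on all lists; \<open>\<rat>\<langle>Perm\<^sub>I\<rangle>\<close> is its subspace of elements supported
  on \<open>Perm I\<close>.
\<close>

definition scaleQ :: "rat \<Rightarrow> (nat list \<Rightarrow>\<^sub>0 rat) \<Rightarrow> (nat list \<Rightarrow>\<^sub>0 rat)"
  where "scaleQ c p = Poly_Mapping.map ((*) c) p"

lemma lookup_scaleQ: "Poly_Mapping.lookup (scaleQ c p) x = c * Poly_Mapping.lookup p x"
  by (simp add: scaleQ_def Poly_Mapping.map.rep_eq when_def)

global_interpretation Q_space: vector_space scaleQ
  by unfold_locales
    (auto intro!: poly_mapping_eqI simp: lookup_scaleQ lookup_add algebra_simps)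

definition basis_elt :: "nat list \<Rightarrow> (nat list \<Rightarrow>\<^sub>0 rat)"
  where "basis_elt x = Poly_Mapping.single x 1"

text \<open>The length of \<open>u\<close> is even so that the displayed entries form whole blocks.\<close>

definition swap_relations :: "nat set \<Rightarrow> (nat list \<Rightarrow>\<^sub>0 rat) set"
  where "swap_relations I =
    {basis_elt (u @ [a, b] @ v) + basis_elt (u @ [b, a] @ v) | u a b v.
       u @ [a, b] @ v \<in> Perm I \<and> even (length u)}"

definition six_term_relations :: "nat set \<Rightarrow> (nat list \<Rightarrow>\<^sub>0 rat) set"
  where "six_term_relations I =
    {basis_elt (u @ [a, b, c, d] @ v) - basis_elt (u @ [a, c, b, d] @ v)
     + basis_elt (u @ [a, d, b, c] @ v) + basis_elt (u @ [b, c, a, d] @ v)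
     - basis_elt (u @ [b, d, a, c] @ v) + basis_elt (u @ [c, d, a, b] @ v) | u a b c d v.
       u @ [a, b, c, d] @ v \<in> Perm I \<and> even (length u)}"

definition M_Perm :: "nat set \<Rightarrow> (nat list \<Rightarrow>\<^sub>0 rat) set"
  where "M_Perm I = Q_space.span (swap_relations I \<union> six_term_relations I)"

text \<open>
  \<open>struct_const I x \<alpha>\<close> is \<open>\<C>\<^sup>\<alpha>\<^sub>x\<close>: equality of two classes in \<open>\<rat>\<langle>Perm\<^sub>I\<rangle>/M\<^sub>I\<close> means that the
  difference of the representatives lies in \<open>M_Perm I\<close>.  Coefficients outside \<open>Alt I\<close> are set to 0 only
  to make the coefficient function unique.
\<close>

definition struct_const :: "nat set \<Rightarrow> nat list \<Rightarrow> nat list \<Rightarrow> rat"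
  where "struct_const I x =
    (THE c. (\<forall>\<beta>. \<beta> \<notin> Alt I \<longrightarrow> c \<beta> = 0) \<and>
            basis_elt x - (\<Sum>\<beta>\<in>Alt I. scaleQ (c \<beta>) (basis_elt \<beta>)) \<in> M_Perm I)"


subsection \<open>The complexes\<close>

text \<open>
  With 0-based positions, \<open>\<Sigma>\<^sup>x\<^sub>i\<close> of the text is \<open>Sig x (i - 1)\<close>; for \<open>i = 1, 2\<close> the initial part is
  empty and the set is the singleton \<open>{x\<^sub>i}\<close>.  Simplicial complexes are given as sets of faces,
  including the empty face.
\<close>

definition Sig :: "nat list \<Rightarrow> nat \<Rightarrow> nat set"
  where "Sig x i = insert (x ! i) (set (take (2 * (i div 2)) x))"

definition points :: "'v set \<Rightarrow> 'v set set"
  where "points V = insert {} {{v} | v. v \<in> V}"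

text \<open>
  The join of complexes on disjoint vertex sets.  In \<open>Delta\<close> the vertex sets are disjoint because
  the vertices in the \<open>j\<close>-th pair have cardinality \<open>2j+1\<close>.
\<close>

definition join :: "'v set set \<Rightarrow> 'v set set \<Rightarrow> 'v set set"
  where "join K L = {s \<union> t | s t. s \<in> K \<and> t \<in> L}"

definition Delta :: "nat list \<Rightarrow> nat set set set"
  where "Delta x =
    foldr join (map (\<lambda>j. points {Sig x (2 * j), Sig x (2 * j + 1)}) [0..<length x div 2]) {{}}"

definition phi :: "nat list \<Rightarrow> nat set set"
  where "phi x = {Sig x (2 * j) | j. j < length x div 2}"


subsection \<open>The order\<close>

definition lessdot :: "nat set \<Rightarrow> nat list \<Rightarrow> nat list \<Rightarrow> bool"
  where "lessdot I x \<alpha> \<longleftrightarrow> x \<in> Perm I \<and> \<alpha> \<in> Alt I \<and> x \<noteq> \<alpha> \<and> phi \<alpha> \<in> Delta x"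

definition preceq :: "nat set \<Rightarrow> nat list \<Rightarrow> nat list \<Rightarrow> bool"
  where "preceq I x y \<longleftrightarrow> x \<in> Perm I \<and> y \<in> Perm I \<and> (lessdot I)\<^sup>*\<^sup>* x y"


subsection \<open>The sign\<close>

definition S_even :: "nat \<Rightarrow> (nat \<Rightarrow> nat) set"
  where "S_even k = {foldr (\<circ>) (map s [0..<k]) id | s. \<forall>j<k. s j permutes {2 * j, 2 * j + 1}}"

definition S_odd :: "nat \<Rightarrow> (nat \<Rightarrow> nat) set"
  where "S_odd k =
    {foldr (\<circ>) (map s [0..<k - 1]) id | s. \<forall>j<k - 1. s j permutes {2 * j + 1, 2 * j + 2}}"

text \<open>
  The action on positions \<open>(\<sigma>\<cdot>x)\<^sub>i = x\<^bsub>\<sigma>(i)\<^esub>\<close> is \<^const>\<open>permute_list\<close>.  If \<open>phi \<alpha> \<in> Delta x\<close>, the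
  pair \<open>(\<tau>, \<sigma>)\<close> exists and is unique; otherwise the value is irrelevant.
\<close>

definition tau :: "nat list \<Rightarrow> nat list \<Rightarrow> (nat \<Rightarrow> nat)"
  where "tau \<alpha> x =
    (THE \<tau>. \<tau> \<in> S_even (length \<alpha> div 2) \<and>
       (\<exists>\<sigma>\<in>S_odd (length \<alpha> div 2). permute_list \<tau> (permute_list \<sigma> \<alpha>) = x))"


subsection \<open>The function on intervals\<close>

text \<open>
  For the termination of the recursion defining \<open>f_Perm\<close>: passing from \<open>\<alpha>\<close> to some \<open>\<beta>\<close> with
  \<open>lessdot I \<beta> \<alpha>\<close>, no sum of an initial segment of blocks increases, and if all of these sums are
  unchanged then \<open>\<beta>\<close> is not alternating.
\<close>

definition weight :: "nat list \<Rightarrow> nat"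
  where "weight x = (\<Sum>j\<in>{j. 2 * j + 2 < length x}. \<Sum>(set (take (2 * j + 2) x)))"

lemma Delta_aux:
  assumes "s \<in> foldr join (map (\<lambda>j. points (V j)) js) {{}}" "v \<in> s"
  shows "\<exists>j\<in>set js. v \<in> V j"
  using assms
  by (induction js arbitrary: s) (auto simp: join_def points_def)

lemma card_Sig:
  assumes "distinct x" "i < length x"
  shows "card (Sig x i) = 2 * (i div 2) + 1"
proof -
  have "x ! i \<notin> set (take (2 * (i div 2)) x)"
    using assms by (auto simp: in_set_conv_nth nth_eq_iff_index_eq)
  moreover have "card (set (take (2 * (i div 2)) x)) = 2 * (i div 2)"
    using assms by (subst distinct_card) auto
  ultimately show ?thesis
    by (simp add: Sig_def)
qed

lemma Perm_lengthD: "x \<in> Perm I \<Longrightarrow> length x = card I"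
  by (auto simp: permutations_of_set_def distinct_card)

lemma lessdot_basics:
  assumes "lessdot I x \<alpha>"
  shows "distinct x" "distinct \<alpha>" "set x = set \<alpha>" "length x = length \<alpha>" "alternating \<alpha>" "x \<noteq> \<alpha>"
    "phi \<alpha> \<in> Delta x"
  using assms Perm_lengthD[of x I] Perm_lengthD[of \<alpha> I]
  by (auto simp: lessdot_def Alt_def permutations_of_set_def)

lemma lessdot_Sig:
  assumes "lessdot I x \<alpha>" "j < length \<alpha> div 2"
  shows "Sig \<alpha> (2 * j) \<in> {Sig x (2 * j), Sig x (2 * j + 1)}"
proof -
  note [simp] = lessdot_basics(4)[OF assms(1)]
  note d = lessdot_basics(1,2)[OF assms(1)]
  have "Sig \<alpha> (2 * j) \<in> phi \<alpha>"
    using assms(2) by (auto simp: phi_def)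
  then obtain i where i: "i < length x div 2" "Sig \<alpha> (2 * j) \<in> {Sig x (2 * i), Sig x (2 * i + 1)}"
    using Delta_aux[OF lessdot_basics(7)[OF assms(1), unfolded Delta_def]] by fastforce
  have "card (Sig \<alpha> (2 * j)) = 2 * j + 1"
    using card_Sig[OF d(2), of "2 * j"] assms(2) by simp
  moreover have "card (Sig \<alpha> (2 * j)) = 2 * i + 1"
    using i card_Sig[OF d(1), of "2 * i"] card_Sig[OF d(1), of "2 * i + 1"] by auto
  ultimately show ?thesis
    using i by simp
qed

lemma set_take_two:
  "2 * j + 1 < length x \<Longrightarrow>
    set (take (2 * j + 2) x) = insert (x ! (2 * j)) (insert (x ! (2 * j + 1)) (set (take (2 * j) x)))"
  by (auto simp: take_Suc_conv_app_nth)

lemma set_take_Suc: "m < length x \<Longrightarrow> set (take (Suc m) x) = insert (x ! m) (set (take m x))"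
  by (simp add: take_Suc_conv_app_nth)

lemma nth_notin_take:
  "distinct x \<Longrightarrow> i < length x \<Longrightarrow> m \<le> i \<Longrightarrow> x ! i \<notin> set (take m x)"
  by (auto simp: in_set_conv_nth nth_eq_iff_index_eq)

lemma sum_take_le:
  assumes "lessdot I x \<alpha>" "2 * j + 2 < length \<alpha>"
  shows "\<Sum>(set (take (2 * j + 2) x)) \<le> \<Sum>(set (take (2 * j + 2) \<alpha>))"
    and "\<Sum>(set (take (2 * j + 2) x)) = \<Sum>(set (take (2 * j + 2) \<alpha>)) \<Longrightarrow>
         set (take (2 * j + 2) x) = set (take (2 * j + 2) \<alpha>)"
proof -
  note [simp] = lessdot_basics(4)[OF assms(1)]
  note d = lessdot_basics(1,2)[OF assms(1)]
  define P where "P = insert (\<alpha> ! (2 * j)) (set (take (2 * j) \<alpha>))"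
  define B where "B = set (take (2 * j + 2) x)"
  define A where "A = set (take (2 * j + 2) \<alpha>)"
  define b where "b = \<alpha> ! (2 * j + 1)"
  define c where "c = \<alpha> ! (2 * j + 2)"
  have less: "c < b"
    using lessdot_basics(5)[OF assms(1)] assms(2)
    unfolding alternating_def b_def c_def by (auto dest!: spec[of _ "2 * j + 1"])
  have fin: "finite P" by (simp add: P_def)
  have P_Sig: "P = Sig \<alpha> (2 * j)"
    by (simp add: P_def Sig_def)
  have B_eq: "B = insert (x ! (2 * j)) (insert (x ! (2 * j + 1)) (set (take (2 * j) x)))"
    unfolding B_def by (rule set_take_two) (use assms(2) in simp)
  have "P = Sig x (2 * j) \<or> P = Sig x (2 * j + 1)"
    using lessdot_Sig[OF assms(1), of j] assms(2) unfolding P_Sig by simp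
  moreover have "Sig x (2 * j) \<subseteq> B" "Sig x (2 * j + 1) \<subseteq> B"
    unfolding B_eq Sig_def by auto
  ultimately have PB: "P \<subseteq> B"
    by metis
  have cP: "card P = 2 * j + 1"
    using card_Sig[OF d(2), of "2 * j"] assms(2) unfolding P_Sig by simp
  have cB: "card B = 2 * j + 2"
    unfolding B_def using assms(2) d(1) by (subst distinct_card) auto
  have A: "A = insert b P"
    unfolding A_def P_def b_def using assms(2) by (subst set_take_two) auto
  have bP: "b \<notin> P"
    using nth_notin_take[OF d(2), of "2 * j + 1" "2 * j"] d(2) assms(2)
    by (simp add: b_def P_def nth_eq_iff_index_eq)
  have BA: "B \<subseteq> insert c A"
  proof (cases "j + 1 < length \<alpha> div 2")
    case True
    have "insert c A = Sig \<alpha> (2 * (j + 1))"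
      by (simp add: Sig_def A_def c_def)
    moreover have "B \<subseteq> Sig x (2 * (j + 1))" "B \<subseteq> Sig x (2 * (j + 1) + 1)"
      by (auto simp: Sig_def B_def)
    ultimately show ?thesis
      using lessdot_Sig[OF assms(1) True] by (metis insertE singletonD)
  next
    case False
    then have "length \<alpha> = Suc (2 * j + 2)"
      using assms(2) by presburger
    then have "set \<alpha> = insert c A"
      unfolding A_def c_def
      using set_take_Suc[OF assms(2)] by (metis take_all order_refl)
    then show ?thesis
      unfolding B_def using lessdot_basics(3)[OF assms(1)] set_take_subset by metis
  qed
  have "card (B - P) = 1"
    using PB cP cB fin by (subst card_Diff_subset) auto
  then obtain y where y: "B - P = {y}"
    by (auto simp: card_1_singleton_iff)
  then have B: "B = insert y P" "y \<notin> P"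
    using PB by auto
  have ybc: "y = b \<or> y = c"
    using y BA A by auto
  have sA: "\<Sum>A = b + \<Sum>P" and sB: "\<Sum>B = y + \<Sum>P"
    using A B bP fin by simp_all
  show "\<Sum>(set (take (2 * j + 2) x)) \<le> \<Sum>(set (take (2 * j + 2) \<alpha>))"
    unfolding A_def[symmetric] B_def[symmetric] sA sB using ybc less by auto
  show "\<Sum>(set (take (2 * j + 2) x)) = \<Sum>(set (take (2 * j + 2) \<alpha>)) \<Longrightarrow>
         set (take (2 * j + 2) x) = set (take (2 * j + 2) \<alpha>)"
    unfolding A_def[symmetric] B_def[symmetric] sA sB using ybc less A B(1) by auto
qed

lemma alternating_eqI:
  assumes "alternating x" "alternating y" "distinct x" "distinct y" "set x = set y"
    and "\<And>j. 2 * j + 2 < length y \<Longrightarrow> set (take (2 * j + 2) x) = set (take (2 * j + 2) y)"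
  shows "x = y"
proof -
  have len [simp]: "length x = length y"
    using assms(3-5) by (metis distinct_card)
  have step: "set (take (2 * j + 2) x) = set (take (2 * j + 2) y)" if "2 * j + 2 \<le> length y" for j
    using assms(5,6) that by (cases "2 * j + 2 = length y") auto
  have *: "2 * j \<le> length y \<Longrightarrow> take (2 * j) x = take (2 * j) y" for j
  proof (induction j)
    case (Suc j)
    then have IH: "take (2 * j) x = take (2 * j) y" and l: "2 * j + 1 < length y"
      by auto
    have "{x ! (2 * j), x ! (2 * j + 1)} = set (take (2 * j + 2) x) - set (take (2 * j) x)"
      using set_take_two[of j x] nth_notin_take[OF assms(3)] l by auto
    also have "\<dots> = {y ! (2 * j), y ! (2 * j + 1)}"
      using step[of j] IH set_take_two[of j y] nth_notin_take[OF assms(4)] l by auto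
    finally have "{x ! (2 * j), x ! (2 * j + 1)} = {y ! (2 * j), y ! (2 * j + 1)}" .
    moreover have "x ! (2 * j) < x ! (2 * j + 1)" "y ! (2 * j) < y ! (2 * j + 1)"
      using assms(1,2) l unfolding alternating_def by (auto dest!: spec[of _ "2 * j"])
    ultimately have "x ! (2 * j) = y ! (2 * j)" "x ! (2 * j + 1) = y ! (2 * j + 1)"
      by (auto simp: doubleton_eq_iff)
    then show ?case
      using IH l by (simp add: take_Suc_conv_app_nth)
  qed simp
  show ?thesis
  proof (cases "even (length y)")
    case True
    then show ?thesis
      using *[of "length y div 2"] by simp
  next
    case False
    define m where "m = 2 * (length y div 2)"
    have m: "length y = Suc m"
      using False by (simp add: m_def)
    have t: "take m x = take m y"
      using *[of "length y div 2"] by (simp add: m_def)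
    have xy: "x = take m x @ [x ! m]" "y = take m y @ [y ! m]"
      using m by (metis len lessI order_refl take_Suc_conv_app_nth take_all)+
    have "x ! m \<notin> set (take m x)" "x ! m \<in> set y"
      using nth_notin_take[OF assms(3), of m m] m assms(5) nth_mem[of m x] by auto
    moreover have "set y = insert (y ! m) (set (take m y))"
      by (subst xy(2)) simp
    ultimately have "x ! m = y ! m"
      using t by auto
    then show ?thesis
      using xy t by metis
  qed
qed

lemma lessdot_measure:
  assumes "lessdot I x \<alpha>"
  shows "2 * weight x + (if alternating x then 1 else 0)
       < 2 * weight \<alpha> + (if alternating \<alpha> then 1 else 0)"
proof -
  note [simp] = lessdot_basics(4)[OF assms]
  have fin: "finite {j. 2 * j + 2 < length \<alpha>}"
    by (rule finite_subset[of _ "{..length \<alpha>}"]) auto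
  have le: "weight x \<le> weight \<alpha>"
    unfolding weight_def using sum_take_le(1)[OF assms] by (auto intro!: sum_mono)
  have "weight x < weight \<alpha>" if "alternating x"
  proof (rule ccontr)
    assume "\<not> weight x < weight \<alpha>"
    then have eq: "weight x = weight \<alpha>"
      using le by simp
    have "\<Sum>(set (take (2 * j + 2) x)) = \<Sum>(set (take (2 * j + 2) \<alpha>))"
      if "2 * j + 2 < length \<alpha>" for j
    proof (rule ccontr)
      assume "\<Sum>(set (take (2 * j + 2) x)) \<noteq> \<Sum>(set (take (2 * j + 2) \<alpha>))"
      then have "weight x < weight \<alpha>"
        unfolding weight_def lessdot_basics(4)[OF assms]
        using fin that sum_take_le(1)[OF assms]
        by (intro sum_strict_mono_ex1) (auto simp: le_less)
      then show False
        using eq by simp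
    qed
    then have "x = \<alpha>"
      using sum_take_le(2)[OF assms] that lessdot_basics[OF assms]
      by (intro alternating_eqI) auto
    then show False
      using lessdot_basics(6)[OF assms] by simp
  qed
  then show ?thesis
    using le lessdot_basics(5)[OF assms] by auto
qed

text \<open>
  \<open>f_Perm I x \<alpha>\<close> is the value of \<open>f\<^sub>I\<close> on the interval \<open>[x, \<alpha>]\<close>; it is only meaningful for
  \<open>preceq I x \<alpha>\<close>.
\<close>

function f_Perm :: "nat set \<Rightarrow> nat list \<Rightarrow> nat list \<Rightarrow> int"
  where "f_Perm I x \<alpha> =
    (if \<alpha> = x \<and> x \<notin> Alt I then -1
     else if x \<in> Alt I then (if \<alpha> = x then 1 else 0)
     else - (\<Sum>\<beta>\<in>{\<beta>. preceq I x \<beta> \<and> lessdot I \<beta> \<alpha>}. sign (tau \<alpha> \<beta>) * f_Perm I x \<beta>))"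
  by pat_completeness auto
termination
  by (relation "measure (\<lambda>(I, x, \<alpha>). 2 * weight \<alpha> + (if alternating \<alpha> then 1 else 0))")
    (simp, simp only: in_measure prod.case mem_Collect_eq, blast intro: lessdot_measure)

declare f_Perm.simps [simp del]

end

theory Submission
  imports Defs
begin

text \<open>
  The coefficient of the facet \<open>phi \<alpha>\<close> in the fundamental cycle of the cross-polytope \<open>Delta x\<close> is
  \<open>sgn \<tau>\<close> or 0.  As a function of \<open>x\<close> it vanishes on the relations, and by \<open>lessdot_measure\<close> it is
  unitriangular on alternating permutations.  So the structure constants are the unique solution of a
  triangular linear system, which is the recursion defining \<open>f_Perm\<close>.  That a solution exists is
  a straightening argument: the six-term relation rewrites \<open>ab/cd\<close> with \<open>a < b < c < d\<close>.
\<close>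

subsection \<open>Facet coefficients\<close>

text \<open>The fundamental cycle of \<open>Delta x\<close> is the product over the blocks of first
  vertex minus second vertex. Here it is evaluated at an arbitrary weighting \<open>g\<close> of the
  vertices, so that relations between cycles become polynomial identities in the values of
  \<open>g\<close>.\<close>

definition cycle_coeff :: "(nat \<Rightarrow> nat set \<Rightarrow> rat) \<Rightarrow> nat list \<Rightarrow> rat"
  where "cycle_coeff g x =
    (\<Prod>j<length x div 2. g j (Sig x (2 * j)) - g j (Sig x (2 * j + 1)))"

text \<open>With \<open>g\<close> the indicator of the vertices of \<open>phi \<alpha>\<close>,
  expanding the product leaves only the term of that facet.\<close>

definition facet_coeff :: "nat list \<Rightarrow> nat list \<Rightarrow> rat"
  where "facet_coeff \<alpha> = cycle_coeff (\<lambda>j s. of_bool (s = Sig \<alpha> (2 * j)))"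

text \<open>Recursive form of \<open>cycle_coeff\<close>: \<open>j\<close> counts the blocks already
  read and \<open>P\<close> collects their entries. A vertex depends on the earlier blocks only
  through these two data.\<close>

fun block_product :: "(nat \<Rightarrow> nat set \<Rightarrow> rat) \<Rightarrow> nat \<Rightarrow> nat set \<Rightarrow> nat list \<Rightarrow> rat"
  where
    "block_product g j P (a # b # v) =
      (g j (insert a P) - g j (insert b P)) * block_product g (Suc j) (insert a (insert b P)) v"
  | "block_product g j P v = 1"

text \<open>Localizes the relations: lists that differ only by rearranging whole blocks inside a
  window share every factor outside it.\<close>

lemma block_product_append:
  assumes "even (length u)"
  shows "block_product g j P (u @ w) =
    block_product g j P u * block_product g (j + length u div 2) (set u \<union> P) w"
  using assms
  by (induction g j P u rule: block_product.induct) (auto simp: insert_commute)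

lemma block_product_eq_prod:
  "block_product g m P x =
    (\<Prod>j<length x div 2. g (m + j) (Sig x (2 * j) \<union> P) - g (m + j) (Sig x (2 * j + 1) \<union> P))"
proof (induction g m P x rule: block_product.induct)
  case (1 g m P a b v)
  have "Sig (a # b # v) (2 * Suc j) \<union> P = Sig v (2 * j) \<union> insert a (insert b P)"
    "Sig (a # b # v) (2 * Suc j + 1) \<union> P = Sig v (2 * j + 1) \<union> insert a (insert b P)" for j
    by (auto simp: Sig_def)
  moreover have "Sig (a # b # v) 0 = {a}" "Sig (a # b # v) (Suc 0) = {b}"
    by (auto simp: Sig_def)
  ultimately show ?case
    using 1 by (simp add: prod.lessThan_Suc_shift del: prod.lessThan_Suc)
qed auto

lemma cycle_coeff_eq: "cycle_coeff g x = block_product g 0 {} x"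
  by (simp add: block_product_eq_prod cycle_coeff_def)

lemma cycle_coeff_swap:
  assumes "even (length u)"
  shows "cycle_coeff g (u @ [a, b] @ v) + cycle_coeff g (u @ [b, a] @ v) = 0"
  using assms by (simp add: cycle_coeff_eq block_product_append insert_commute algebra_simps)

text \<open>After the common factors are split off, the second factor involves only vertices with
  three of the four entries. The coefficient of the vertex with \<open>a\<close>, \<open>b\<close>,
  \<open>c\<close> is \<open>(A - B) - (A - C) + (B - C) = 0\<close> in the values of
  \<open>g\<close> on the first-level vertices, and the other three vanish in the same way.\<close>

lemma cycle_coeff_six_term:
  assumes "even (length u)"
  shows "cycle_coeff g (u @ [a, b, c, d] @ v) - cycle_coeff g (u @ [a, c, b, d] @ v)
    + cycle_coeff g (u @ [a, d, b, c] @ v) + cycle_coeff g (u @ [b, c, a, d] @ v)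
    - cycle_coeff g (u @ [b, d, a, c] @ v) + cycle_coeff g (u @ [c, d, a, b] @ v) = 0"
proof -
  \<comment> \<open>Orders nested insertions as \<open>a\<close>, \<open>b\<close>,
    \<open>c\<close>, \<open>d\<close>, so that equal vertices become syntactically equal and
    cancel.\<close>
  have "insert b (insert a P) = insert a (insert b P)"
    "insert c (insert a P) = insert a (insert c P)"
    "insert c (insert b P) = insert b (insert c P)"
    "insert d (insert a P) = insert a (insert d P)"
    "insert d (insert b P) = insert b (insert d P)"
    "insert d (insert c P) = insert c (insert d P)" for P
    by auto
  then show ?thesis
    using assms by (simp add: cycle_coeff_eq block_product_append algebra_simps)
qed

section \<open>Linear extension to the free space, and vanishing on the relations\<close>

definition coeff_functional ::
    "nat set \<Rightarrow> (nat list \<Rightarrow> rat) \<Rightarrow> (nat list \<Rightarrow>\<^sub>0 rat) \<Rightarrow> rat"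
  where "coeff_functional I h p = (\<Sum>x\<in>Perm I. Poly_Mapping.lookup p x * h x)"

lemma coeff_functional_add:
  "coeff_functional I h (p + q) = coeff_functional I h p + coeff_functional I h q"
  by (simp add: coeff_functional_def lookup_add algebra_simps sum.distrib)

lemma coeff_functional_diff:
  "coeff_functional I h (p - q) = coeff_functional I h p - coeff_functional I h q"
  by (simp add: coeff_functional_def lookup_minus algebra_simps sum_subtractf)

lemma coeff_functional_scaleQ: "coeff_functional I h (scaleQ c p) = c * coeff_functional I h p"
  by (simp add: coeff_functional_def lookup_scaleQ sum_distrib_left mult.assoc)

lemma coeff_functional_sum:
  "coeff_functional I h (\<Sum>x\<in>A. p x) = (\<Sum>x\<in>A. coeff_functional I h (p x))"
  by (induction A rule: infinite_finite_induct)
    (simp_all add: coeff_functional_add, simp_all add: coeff_functional_def)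

lemma coeff_functional_basis_elt:
  assumes "x \<in> Perm I"
  shows "coeff_functional I h (basis_elt x) = h x"
proof -
  have "coeff_functional I h (basis_elt x) = (\<Sum>y\<in>Perm I. if y = x then h y else 0)"
    unfolding coeff_functional_def basis_elt_def
    by (intro sum.cong) (auto simp: lookup_single when_def)
  then show ?thesis
    using assms by simp
qed

lemma Perm_mset_eq:
  assumes "x \<in> Perm I" "mset y = mset x"
  shows "y \<in> Perm I"
  using assms mset_eq_setD[OF assms(2)] mset_eq_imp_distinct_iff[OF assms(2)]
  by (auto simp: permutations_of_set_def)

lemma coeff_functional_M_Perm:
  assumes "p \<in> M_Perm I"
  shows "coeff_functional I (cycle_coeff g) p = 0"
  using assms unfolding M_Perm_def
proof (induction rule: Q_space.span_induct_alt)
  case base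
  show ?case
    by (simp add: coeff_functional_def)
next
  case (step c r q)
  have "coeff_functional I (cycle_coeff g) r = 0"
    using step(1)
  proof
    assume "r \<in> swap_relations I"
    then obtain u a b v where *: "r = basis_elt (u @ [a, b] @ v) + basis_elt (u @ [b, a] @ v)"
      "u @ [a, b] @ v \<in> Perm I" "even (length u)"
      unfolding swap_relations_def by blast
    have "u @ [b, a] @ v \<in> Perm I"
      by (rule Perm_mset_eq[OF *(2)]) simp
    then show ?thesis
      using * cycle_coeff_swap[OF *(3)]
      by (simp add: coeff_functional_add coeff_functional_basis_elt)
  next
    assume "r \<in> six_term_relations I"
    then obtain u a b c d v where *:
      "r = basis_elt (u @ [a, b, c, d] @ v) - basis_elt (u @ [a, c, b, d] @ v)
       + basis_elt (u @ [a, d, b, c] @ v) + basis_elt (u @ [b, c, a, d] @ v)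
       - basis_elt (u @ [b, d, a, c] @ v) + basis_elt (u @ [c, d, a, b] @ v)"
      "u @ [a, b, c, d] @ v \<in> Perm I" "even (length u)"
      unfolding six_term_relations_def by blast
    have "u @ [a, c, b, d] @ v \<in> Perm I" "u @ [a, d, b, c] @ v \<in> Perm I"
      "u @ [b, c, a, d] @ v \<in> Perm I" "u @ [b, d, a, c] @ v \<in> Perm I"
      "u @ [c, d, a, b] @ v \<in> Perm I"
      by (rule Perm_mset_eq[OF *(2)], simp)+
    then show ?thesis
      using * cycle_coeff_six_term[OF *(3)]
      by (simp add: coeff_functional_add coeff_functional_diff coeff_functional_basis_elt)
  qed
  then show ?case
    using step(2) by (simp add: coeff_functional_add coeff_functional_scaleQ)
qed


subsection \<open>Block permutations and signs\<close>

text \<open>A factor maps its own set to itself, and every other factor fixes that set pointwise.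
  The composition therefore acts on each set as its own factor, whatever the order.\<close>

lemma foldr_comp_disjoint:
  assumes "distinct js" "disjoint_family_on B (set js)" "\<And>j. j \<in> set js \<Longrightarrow> s j permutes B j"
  shows "i \<notin> (\<Union>j\<in>set js. B j) \<Longrightarrow> foldr (\<circ>) (map s js) id i = i"
    and "j \<in> set js \<Longrightarrow> i \<in> B j \<Longrightarrow> foldr (\<circ>) (map s js) id i = s j i"
proof -
  have "(i \<notin> (\<Union>j\<in>set js. B j) \<longrightarrow> foldr (\<circ>) (map s js) id i = i) \<and>
    (\<forall>j\<in>set js. i \<in> B j \<longrightarrow> foldr (\<circ>) (map s js) id i = s j i)"
    using assms
  proof (induction js)
    case (Cons l js)
    define F where "F = foldr (\<circ>) (map s js) id"
    have IH: "(i \<notin> (\<Union>j\<in>set js. B j) \<longrightarrow> F i = i) \<and> (\<forall>j\<in>set js. i \<in> B j \<longrightarrow> F i = s j i)"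
      unfolding F_def
      by (rule Cons.IH) (use Cons.prems in \<open>auto simp: disjoint_family_on_def\<close>)
    have disj: "B l \<inter> B j = {}" if "j \<in> set js" for j
      using Cons.prems(1,2) that by (auto simp: disjoint_family_on_def)
    have sl: "s l permutes B l"
      using Cons.prems(3) by simp
    have "s l (s j i) = s j i" if "j \<in> set js" "i \<in> B j" for j
    proof -
      have "s j i \<in> B j"
        using Cons.prems(3)[of j] that by (simp add: permutes_in_image)
      then show ?thesis
        using disj[OF that(1)] permutes_not_in[OF sl] by blast
    qed
    moreover have "i \<in> B l \<Longrightarrow> i \<notin> (\<Union>j\<in>set js. B j)"
      using disj by auto
    moreover have eq: "foldr (\<circ>) (map s (l # js)) id i = s l (F i)"
      by (simp add: F_def)
    ultimately show ?case
      unfolding eq using IH permutes_not_in[OF sl] by auto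
  qed simp
  then show "i \<notin> (\<Union>j\<in>set js. B j) \<Longrightarrow> foldr (\<circ>) (map s js) id i = i"
    and "j \<in> set js \<Longrightarrow> i \<in> B j \<Longrightarrow> foldr (\<circ>) (map s js) id i = s j i"
    by auto
qed

lemma sign_foldr_comp:
  assumes "\<And>j. j \<in> set js \<Longrightarrow> permutation (s j)"
  shows "permutation (foldr (\<circ>) (map s js) id) \<and>
    sign (foldr (\<circ>) (map s js) id) = (\<Prod>j\<leftarrow>js. sign (s j))"
  using assms
  by (induction js) (auto simp: permutation_compose sign_compose permutation_id)

lemma permutes_doubleton:
  assumes "p permutes {a, b}" "a \<noteq> b"
  shows "p = id \<or> p = transpose a b"
proof (cases "p a = a")
  case True
  then have "p b = b"
    using assms permutes_in_image[OF assms(1), of b] permutes_inj[OF assms(1)]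
    by (auto dest: injD)
  then have "p = id"
    using True permutes_not_in[OF assms(1)] by (auto simp: fun_eq_iff) (metis)
  then show ?thesis ..
next
  case False
  then have "p a = b"
    using permutes_in_image[OF assms(1), of a] by auto
  moreover have "p b = a"
  proof (rule ccontr)
    assume "p b \<noteq> a"
    then have "p b = p a"
      using permutes_in_image[OF assms(1), of b] \<open>p a = b\<close> by auto
    then show False
      using assms(2) permutes_inj[OF assms(1)] by (auto dest: injD)
  qed
  ultimately have "p = transpose a b"
    using permutes_not_in[OF assms(1)] by (auto simp: fun_eq_iff transpose_def)
  then show ?thesis ..
qed

text \<open>Each block is either kept or swapped, and the sign counts the swapped blocks. Only these
  facts about the group are used afterwards.\<close>

lemma S_evenE:
  assumes "\<tau> \<in> S_even k"
  shows "\<And>j. j < k \<Longrightarrow> \<tau> (2 * j) = 2 * j \<and> \<tau> (2 * j + 1) = 2 * j + 1 \<or>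
      \<tau> (2 * j) = 2 * j + 1 \<and> \<tau> (2 * j + 1) = 2 * j"
    and "\<And>i. 2 * k \<le> i \<Longrightarrow> \<tau> i = i"
    and "sign \<tau> = (\<Prod>j<k. if \<tau> (2 * j) = 2 * j then 1 else -1)"
proof -
  obtain s where s: "\<tau> = foldr (\<circ>) (map s [0..<k]) id" "\<forall>j<k. s j permutes {2 * j, 2 * j + 1}"
    using assms unfolding S_even_def by blast
  have disj: "disjoint_family_on (\<lambda>j. {2 * j, 2 * j + 1}) (set [0..<k])"
    unfolding disjoint_family_on_def by (auto; presburger)
  note f = foldr_comp_disjoint[OF distinct_upt disj, of s, folded s(1)]
  have sj: "\<tau> (2 * j) = s j (2 * j)" "\<tau> (2 * j + 1) = s j (2 * j + 1)" if "j < k" for j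
    using f(2)[of j] s(2) that by auto
  have cases: "s j = id \<or> s j = transpose (2 * j) (2 * j + 1)" if "j < k" for j
    using permutes_doubleton[of "s j" "2 * j" "2 * j + 1"] s(2) that by simp
  show "\<tau> (2 * j) = 2 * j \<and> \<tau> (2 * j + 1) = 2 * j + 1 \<or>
      \<tau> (2 * j) = 2 * j + 1 \<and> \<tau> (2 * j + 1) = 2 * j" if "j < k" for j
    using cases[OF that] sj[OF that] by auto
  show "\<tau> i = i" if "2 * k \<le> i" for i
    by (rule f(1)) (use s(2) that in auto)
  have "permutation (s j)" if "j < k" for j
    using s(2) that permutes_imp_permutation[of "{2 * j, 2 * j + 1}" "s j"] by simp
  then have "sign \<tau> = (\<Prod>j<k. sign (s j))"
    using sign_foldr_comp[of "[0..<k]" s] s(1)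
    by (simp add: interv_sum_list_conv_sum_set_nat prod.distinct_set_conv_list[symmetric]
        atLeast0LessThan)
  also have "\<dots> = (\<Prod>j<k. if \<tau> (2 * j) = 2 * j then 1 else -1)"
  proof (rule prod.cong[OF refl])
    fix j assume "j \<in> {..<k}"
    then have "j < k" by simp
    then show "sign (s j) = (if \<tau> (2 * j) = 2 * j then 1 else -1)"
      using cases[of j] sj[of j] by (auto simp: sign_id sign_swap_id)
  qed
  finally show "sign \<tau> = (\<Prod>j<k. if \<tau> (2 * j) = 2 * j then 1 else -1)" .
qed

text \<open>The segment consists of position 0 and the first \<open>j\<close> odd pairs, so no pair
  straddles its end.\<close>

lemma S_oddE:
  assumes "\<sigma> \<in> S_odd k" "j < k"
  shows "\<sigma> ` {..<2 * j + 1} = {..<2 * j + 1}"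
proof -
  obtain s where s: "\<sigma> = foldr (\<circ>) (map s [0..<k - 1]) id"
      "\<forall>j<k - 1. s j permutes {2 * j + 1, 2 * j + 2}"
    using assms unfolding S_odd_def by blast
  have disj: "disjoint_family_on (\<lambda>j. {2 * j + 1, 2 * j + 2}) (set [0..<k - 1])"
    unfolding disjoint_family_on_def by (auto; presburger)
  note f = foldr_comp_disjoint[OF distinct_upt disj, of s, folded s(1)]
  have "\<sigma> i < 2 * j + 1" if "i < 2 * j + 1" for i
  proof (cases "i = 0")
    case True
    have "\<sigma> i = i"
      by (rule f(1)) (use s(2) True in auto)
    then show ?thesis
      using that by simp
  next
    case False
    \<comment> \<open>Index of the odd pair \<open>{2 * l + 1, 2 * l + 2}\<close> containing
      \<open>i\<close>.\<close>
    define l where "l = (i - 1) div 2"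
    have l: "l < k - 1" "i \<in> {2 * l + 1, 2 * l + 2}" "l < j"
      using that False assms(2) unfolding l_def by auto
    then have "\<sigma> i = s l i"
      using f(2)[of l i] s(2) by auto
    moreover have "s l i \<in> {2 * l + 1, 2 * l + 2}"
      using permutes_in_image[of "s l" "{2 * l + 1, 2 * l + 2}" i] s(2) l by blast
    ultimately show ?thesis
      using l(3) by auto
  qed
  moreover have "inj \<sigma>"
  proof -
    have "permutation (s j)" if "j < k - 1" for j
      using s(2) that permutes_imp_permutation[of "{2 * j + 1, 2 * j + 2}" "s j"] by simp
    then have "permutation \<sigma>"
      using sign_foldr_comp[of "[0..<k - 1]" s] s(1) by simp
    then show ?thesis
      using permutation_bijective bij_is_inj by blast
  qed
  ultimately show ?thesis
    by (intro endo_inj_surj) (auto intro: inj_on_subset)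
qed

section \<open>Action of the two groups on the vertices\<close>

lemma set_take_eq_image: "n \<le> length x \<Longrightarrow> set (take n x) = (!) x ` {..<n}"
  by (simp add: nth_image[symmetric] atLeast0LessThan)

lemma Sig_even_eq: "2 * j < length x \<Longrightarrow> Sig x (2 * j) = set (take (2 * j + 1) x)"
  by (simp add: Sig_def set_take_Suc)

lemma Sig_permute_odd:
  assumes "\<sigma> \<in> S_odd k" "length \<alpha> = 2 * k" "j < k"
  shows "Sig (permute_list \<sigma> \<alpha>) (2 * j) = Sig \<alpha> (2 * j)"
proof -
  have "Sig (permute_list \<sigma> \<alpha>) (2 * j) = (!) (permute_list \<sigma> \<alpha>) ` {..<2 * j + 1}"
    using assms by (subst Sig_even_eq) (simp_all add: set_take_eq_image)
  also have "\<dots> = (\<lambda>i. \<alpha> ! \<sigma> i) ` {..<2 * j + 1}"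
    using assms by (intro image_cong) (auto simp: permute_list_def)
  also have "\<dots> = (!) \<alpha> ` (\<sigma> ` {..<2 * j + 1})"
    by (simp add: image_image)
  also have "\<dots> = (!) \<alpha> ` {..<2 * j + 1}"
    using S_oddE[OF assms(1,3)] by simp
  also have "\<dots> = Sig \<alpha> (2 * j)"
    using assms by (subst Sig_even_eq) (simp_all add: set_take_eq_image)
  finally show ?thesis .
qed

lemma S_even_div:
  assumes "\<tau> \<in> S_even k"
  shows "\<tau> i div 2 = i div 2"
proof (cases "i < 2 * k")
  case True
  then have "i div 2 < k" by auto
  moreover have "i = 2 * (i div 2) \<or> i = 2 * (i div 2) + 1" by presburger
  ultimately show ?thesis
    using S_evenE(1)[OF assms, of "i div 2"]
    by (metis Suc_eq_plus1 div_mult_self1_is_m even_Suc_div_two even_mult_iff even_numeral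
        zero_less_numeral)
qed (simp add: S_evenE(2)[OF assms])

lemma S_even_involution:
  assumes "\<tau> \<in> S_even k"
  shows "\<tau> (\<tau> i) = i"
proof (cases "i < 2 * k")
  case True
  then have "i div 2 < k" by auto
  moreover have "i = 2 * (i div 2) \<or> i = 2 * (i div 2) + 1" by presburger
  ultimately show ?thesis
    using S_evenE(1)[OF assms, of "i div 2"] by metis
qed (simp add: S_evenE(2)[OF assms])

lemma S_even_less_iff:
  assumes "\<tau> \<in> S_even k"
  shows "\<tau> i < 2 * j \<longleftrightarrow> i < 2 * j"
proof -
  have "a < 2 * j \<longleftrightarrow> a div 2 < j" for a :: nat
    by auto
  then show ?thesis
    by (simp add: S_even_div[OF assms])
qed

lemma permute_list_S_even_involution:
  assumes "\<tau> \<in> S_even k" "length x = 2 * k"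
  shows "permute_list \<tau> (permute_list \<tau> x) = x"
  using assms
  by (intro nth_equalityI)
    (auto simp: permute_list_def S_even_less_iff[OF assms(1)] S_even_involution[OF assms(1)])

text \<open>An element of the even group preserves every initial union of blocks, so it can only
  exchange the two vertices of a pair.\<close>

lemma Sig_permute_even:
  assumes "\<tau> \<in> S_even k" "length y = 2 * k" "i < 2 * k"
  shows "Sig (permute_list \<tau> y) i = Sig y (\<tau> i)"
proof -
  define m where "m = 2 * (i div 2)"
  have m: "m \<le> 2 * k" "even m" "m = 2 * (\<tau> i div 2)"
    using assms S_even_div[OF assms(1), of i] by (auto simp: m_def)
  have "\<tau> ` {..<m} = {..<m}"
  proof (intro endo_inj_surj)
    show "\<tau> ` {..<m} \<subseteq> {..<m}"
      using S_even_less_iff[OF assms(1)] m(2) by (auto elim!: evenE)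
    show "inj_on \<tau> {..<m}"
      using S_even_involution[OF assms(1)] by (metis inj_onI)
  qed simp
  moreover have "(!) (permute_list \<tau> y) ` {..<m} = (\<lambda>i. y ! \<tau> i) ` {..<m}"
    using assms m by (intro image_cong) (auto simp: permute_list_def)
  ultimately have "(!) (permute_list \<tau> y) ` {..<m} = (!) y ` {..<m}"
    by (metis image_image)
  moreover have "permute_list \<tau> y ! i = y ! \<tau> i"
    using assms by (simp add: permute_list_def)
  ultimately show ?thesis
    using assms m(1) unfolding Sig_def m_def[symmetric] m(3)[symmetric]
    by (simp add: set_take_eq_image)
qed

lemma Sig_even_neq_odd:
  assumes "distinct x" "2 * j + 1 < length x"
  shows "Sig x (2 * j) \<noteq> Sig x (2 * j + 1)"
proof -
  have "x ! (2 * j) \<notin> set (take (2 * j) x)" "x ! (2 * j) \<noteq> x ! (2 * j + 1)"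
    using assms nth_notin_take[OF assms(1)] by (auto simp: nth_eq_iff_index_eq)
  then show ?thesis
    by (auto simp: Sig_def)
qed

text \<open>The odd factor leaves the vertices of \<open>phi \<alpha>\<close> unchanged, so
  \<open>\<tau>\<close> can be read off: it swaps block \<open>j\<close> exactly when
  \<open>phi \<alpha>\<close> uses the second vertex of the \<open>j\<close>-th pair of
  \<open>Delta x\<close>. This yields both uniqueness and the sign.\<close>

lemma S_even_fix_iff:
  assumes "\<tau> \<in> S_even k" "\<sigma> \<in> S_odd k" "permute_list \<tau> (permute_list \<sigma> \<alpha>) = x"
    and "length \<alpha> = 2 * k" "distinct x" "j < k"
  shows "(\<tau> (2 * j) = 2 * j \<longleftrightarrow> Sig x (2 * j) = Sig \<alpha> (2 * j)) \<and>
    (\<tau> (2 * j) \<noteq> 2 * j \<longleftrightarrow> Sig x (2 * j + 1) = Sig \<alpha> (2 * j))"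
proof -
  have "Sig x i = Sig (permute_list \<sigma> \<alpha>) (\<tau> i)" if "i < 2 * k" for i
    using Sig_permute_even[OF assms(1), of "permute_list \<sigma> \<alpha>" i] assms(3,4) that by simp
  then have "Sig x (2 * j) = Sig (permute_list \<sigma> \<alpha>) (\<tau> (2 * j))"
    "Sig x (2 * j + 1) = Sig (permute_list \<sigma> \<alpha>) (\<tau> (2 * j + 1))"
    using assms(6) by auto
  moreover have "Sig x (2 * j) \<noteq> Sig x (2 * j + 1)"
    using Sig_even_neq_odd[OF assms(5), of j] assms(3,4,6) by auto
  ultimately show ?thesis
    using S_evenE(1)[OF assms(1,6)] Sig_permute_odd[OF assms(2,4,6)] by auto
qed

lemma S_even_unique:
  fixes \<alpha> x :: "nat list"
  assumes "\<tau> \<in> S_even k" "\<sigma> \<in> S_odd k" "permute_list \<tau> (permute_list \<sigma> \<alpha>) = x"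
    and "\<tau>' \<in> S_even k" "\<sigma>' \<in> S_odd k" "permute_list \<tau>' (permute_list \<sigma>' \<alpha>) = x"
    and "length \<alpha> = 2 * k" "distinct x"
  shows "\<tau> = \<tau>'"
proof
  fix i
  show "\<tau> i = \<tau>' i"
  proof (cases "i < 2 * k")
    case True
    define j where "j = i div 2"
    have j: "j < k" "i = 2 * j \<or> i = 2 * j + 1"
      using True unfolding j_def by auto
    have "\<tau> (2 * j) = 2 * j \<longleftrightarrow> \<tau>' (2 * j) = 2 * j"
      using S_even_fix_iff[OF assms(1-3,7,8) j(1)] S_even_fix_iff[OF assms(4-6,7,8) j(1)] by blast
    then show ?thesis
      using S_evenE(1)[OF assms(1) j(1)] S_evenE(1)[OF assms(4) j(1)] j(2) by auto
  qed (simp add: S_evenE(2)[OF assms(1)] S_evenE(2)[OF assms(4)])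
qed

lemma tau_eqI:
  assumes "\<tau> \<in> S_even k" "\<sigma> \<in> S_odd k" "permute_list \<tau> (permute_list \<sigma> \<alpha>) = x"
    and "length \<alpha> = 2 * k" "distinct x"
  shows "tau \<alpha> x = \<tau>"
  unfolding tau_def
proof (rule the_equality)
  show "\<tau> \<in> S_even (length \<alpha> div 2) \<and>
    (\<exists>\<sigma>\<in>S_odd (length \<alpha> div 2). permute_list \<tau> (permute_list \<sigma> \<alpha>) = x)"
    using assms by auto
next
  fix \<tau>'
  assume "\<tau>' \<in> S_even (length \<alpha> div 2) \<and>
    (\<exists>\<sigma>\<in>S_odd (length \<alpha> div 2). permute_list \<tau>' (permute_list \<sigma> \<alpha>) = x)"
  then show "\<tau>' = \<tau>"
    using S_even_unique[OF _ _ _ assms] assms(4) by auto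
qed

lemma obtain_S_even:
  obtains \<tau> where "\<tau> \<in> S_even k"
    "\<And>j. j < k \<Longrightarrow> \<tau> (2 * j) = (if P j then 2 * j else 2 * j + 1)"
proof -
  define s where "s j = (if P j then id else transpose (2 * j) (2 * j + 1))" for j
  define \<tau> where "\<tau> = foldr (\<circ>) (map s [0..<k]) id"
  have s: "\<forall>j<k. s j permutes {2 * j, 2 * j + 1}"
    by (auto simp: s_def permutes_id intro: permutes_swap_id)
  have disj: "disjoint_family_on (\<lambda>j. {2 * j, 2 * j + 1}) (set [0..<k])"
    unfolding disjoint_family_on_def by (auto; presburger)
  have "\<tau> (2 * j) = s j (2 * j)" if "j < k" for j
    using foldr_comp_disjoint(2)[OF distinct_upt disj, of s j "2 * j"] s that by (simp add: \<tau>_def)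
  then have "\<tau> (2 * j) = (if P j then 2 * j else 2 * j + 1)" if "j < k" for j
    using that by (simp add: s_def)
  moreover have "\<tau> \<in> S_even k"
    unfolding S_even_def \<tau>_def using s by blast
  ultimately show ?thesis
    using that by blast
qed

text \<open>Converse to \<open>Sig_permute_odd\<close>. Equal vertices mean equal sets of entries in
  the initial segments of odd length, and successive differences show that the two lists have the
  same entries on each odd pair.\<close>

lemma obtain_S_odd:
  assumes "distinct y" "distinct \<alpha>" "set y = set \<alpha>" "length y = 2 * k" "length \<alpha> = 2 * k"
    and "\<And>j. j < k \<Longrightarrow> Sig y (2 * j) = Sig \<alpha> (2 * j)"
  obtains \<sigma> where "\<sigma> \<in> S_odd k" "permute_list \<sigma> \<alpha> = y"
proof -
  define s where "s j = (if y ! (2 * j + 1) = \<alpha> ! (2 * j + 1) then id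
    else transpose (2 * j + 1) (2 * j + 2))" for j
  define \<sigma> where "\<sigma> = foldr (\<circ>) (map s [0..<k - 1]) id"
  have s: "\<forall>j<k - 1. s j permutes {2 * j + 1, 2 * j + 2}"
    by (auto simp: s_def permutes_id intro: permutes_swap_id)
  have disj: "disjoint_family_on (\<lambda>j. {2 * j + 1, 2 * j + 2}) (set [0..<k - 1])"
    unfolding disjoint_family_on_def by (auto; presburger)
  note f = foldr_comp_disjoint[OF distinct_upt disj, of s, folded \<sigma>_def]
  have init: "set (take (2 * j + 1) y) = set (take (2 * j + 1) \<alpha>)" if "j < k" for j
    using assms(6)[OF that] assms(4,5) that by (simp add: Sig_even_eq)
  have diff: "set (take (m + 2) z) - set (take m z) = {z ! m, z ! (m + 1)}"
    if "distinct z" "m + 1 < length z" for z :: "nat list" and m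
    using that nth_notin_take[of z m m] nth_notin_take[of z "m + 1" m] by (auto simp: set_take_Suc)
  have "y ! i = \<alpha> ! \<sigma> i" if "i < 2 * k" for i
  proof -
    \<comment> \<open>The first and the last position lie in no odd pair and are fixed by
      \<open>\<sigma>\<close>; the last entry is recovered as the complement of all earlier
      ones.\<close>
    consider "i = 0" | "i = 2 * k - 1" "i > 0"
      | j where "j < k - 1" "i \<in> {2 * j + 1, 2 * j + 2}"
    proof (cases "i = 0 \<or> i = 2 * k - 1")
      case False
      then have "(i - 1) div 2 < k - 1" "i \<in> {2 * ((i - 1) div 2) + 1, 2 * ((i - 1) div 2) + 2}"
        using \<open>i < 2 * k\<close> by auto
      then show ?thesis
        using that(3) by blast
    qed (use that in blast)
    then show ?thesis
    proof cases
      case 1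
      have "\<sigma> 0 = 0"
        by (rule f(1)) (use s in auto)
      moreover have "y ! 0 = \<alpha> ! 0"
        using assms(6)[of 0] \<open>i < 2 * k\<close> by (simp add: Sig_def)
      ultimately show ?thesis
        using 1 by simp
    next
      case 2
      have "i \<notin> (\<Union>j\<in>set [0..<k - 1]. {2 * j + 1, 2 * j + 2})"
      proof
        assume "i \<in> (\<Union>j\<in>set [0..<k - 1]. {2 * j + 1, 2 * j + 2})"
        then obtain j where "j < k - 1" "i = 2 * j + 1 \<or> i = 2 * j + 2"
          by auto
        then show False
          using 2(1) by linarith
      qed
      then have "\<sigma> i = i"
        using s by (intro f(1)) auto
      moreover have "{y ! i} = set y - set (take i y)" "{\<alpha> ! i} = set \<alpha> - set (take i \<alpha>)"
        using 2 that assms(4,5) set_take_Suc[of i y] set_take_Suc[of i \<alpha>]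
          nth_notin_take[OF assms(1), of i i] nth_notin_take[OF assms(2), of i i] by auto
      moreover have "set (take i y) = set (take i \<alpha>)"
      proof -
        have "k - 1 < k" "2 * (k - 1) + 1 = i"
          using 2 that by linarith+
        then show ?thesis
          using init[of "k - 1"] by simp
      qed
      ultimately show ?thesis
        using assms(3) by (metis singleton_inject)
    next
      case 3
      have eq: "{y ! (2 * j + 1), y ! (2 * j + 2)} = {\<alpha> ! (2 * j + 1), \<alpha> ! (2 * j + 2)}"
      proof -
        have e: "2 * j + 1 + 2 = 2 * (j + 1) + 1" "2 * j + 1 + 1 = 2 * j + 2"
          by simp_all
        have "2 * j + 2 < 2 * k" "j < k" "j + 1 < k"
          using 3(1) by linarith+
        then show ?thesis
          using diff[OF assms(1), of "2 * j + 1", unfolded e assms(4)]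
            diff[OF assms(2), of "2 * j + 1", unfolded e assms(5)]
            init[of j] init[of "j + 1"] by metis
      qed
      have "\<sigma> i = s j i"
        using f(2)[of j i] s 3 by auto
      then show ?thesis
        using 3(2) eq by (auto simp: s_def doubleton_eq_iff)
    qed
  qed
  then have "permute_list \<sigma> \<alpha> = y"
    using assms(4,5) by (intro nth_equalityI) (auto simp: permute_list_def)
  moreover have "\<sigma> \<in> S_odd k"
    unfolding S_odd_def \<sigma>_def using s by blast
  ultimately show ?thesis
    using that by blast
qed

section \<open>Facets of the complex and their coefficients\<close>

lemma image_in_join_points:
  "(\<And>j. j \<in> set js \<Longrightarrow> v j \<in> V j) \<Longrightarrow>
    v ` set js \<in> foldr join (map (\<lambda>j. points (V j)) js) {{}}"
proof (induction js)
  case (Cons j js)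
  then have "{v j} \<in> points (V j)"
    by (auto simp: points_def)
  moreover have "v ` set (j # js) = {v j} \<union> v ` set js"
    by simp
  ultimately show ?case
    using Cons unfolding join_def by (simp only: list.map foldr.simps o_apply list.set_intros) blast
qed simp

text \<open>Vertices of the \<open>j\<close>-th pair have cardinality \<open>2 * j + 1\<close>, so a
  vertex of \<open>phi \<alpha>\<close> can only match the pair with its own index.\<close>

lemma phi_in_Delta_iff:
  assumes "distinct x" "distinct \<alpha>" "length x = length \<alpha>"
  shows "phi \<alpha> \<in> Delta x \<longleftrightarrow>
    (\<forall>j<length x div 2. Sig \<alpha> (2 * j) \<in> {Sig x (2 * j), Sig x (2 * j + 1)})"
proof (intro iffI allI impI)
  fix j
  assume D: "phi \<alpha> \<in> Delta x" and j: "j < length x div 2"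
  have "Sig \<alpha> (2 * j) \<in> phi \<alpha>"
    using j assms(3) by (auto simp: phi_def)
  then obtain i where i: "i < length x div 2"
      "Sig \<alpha> (2 * j) \<in> {Sig x (2 * i), Sig x (2 * i + 1)}"
    using Delta_aux[OF D[unfolded Delta_def]] by fastforce
  have "card (Sig \<alpha> (2 * j)) = 2 * j + 1"
    using card_Sig[OF assms(2), of "2 * j"] j assms(3) by simp
  moreover have "card (Sig \<alpha> (2 * j)) = 2 * i + 1"
    using i card_Sig[OF assms(1), of "2 * i"] card_Sig[OF assms(1), of "2 * i + 1"] by auto
  ultimately show "Sig \<alpha> (2 * j) \<in> {Sig x (2 * j), Sig x (2 * j + 1)}"
    using i by simp
next
  assume "\<forall>j<length x div 2. Sig \<alpha> (2 * j) \<in> {Sig x (2 * j), Sig x (2 * j + 1)}"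
  moreover have "phi \<alpha> = (\<lambda>j. Sig \<alpha> (2 * j)) ` set [0..<length x div 2]"
    using assms(3) by (auto simp: phi_def)
  ultimately show "phi \<alpha> \<in> Delta x"
    unfolding Delta_def by (simp only:) (intro image_in_join_points, simp)
qed

text \<open>Factor \<open>j\<close> is 1, -1 or 0 according to whether \<open>phi \<alpha>\<close>
  uses the first, the second or neither vertex of the pair. A nonzero product is thus -1 to the
  number of blocks swapped by \<open>\<tau>\<close>.\<close>

lemma facet_coeff_eq:
  assumes "distinct x" "distinct \<alpha>" "set x = set \<alpha>" "length x = 2 * k" "length \<alpha> = 2 * k"
  shows "facet_coeff \<alpha> x = (if phi \<alpha> \<in> Delta x then of_int (sign (tau \<alpha> x)) else 0)"
proof (cases "phi \<alpha> \<in> Delta x")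
  case True
  then have mem: "Sig \<alpha> (2 * j) \<in> {Sig x (2 * j), Sig x (2 * j + 1)}" if "j < k" for j
    using phi_in_Delta_iff[of x \<alpha>] assms that by simp
  obtain \<tau> where \<tau>: "\<tau> \<in> S_even k"
    "\<And>j. j < k \<Longrightarrow> \<tau> (2 * j) = (if Sig x (2 * j) = Sig \<alpha> (2 * j) then 2 * j else 2 * j + 1)"
    using obtain_S_even[of k "\<lambda>j. Sig x (2 * j) = Sig \<alpha> (2 * j)"] by blast
  have perm: "\<tau> permutes {..<length x}"
  proof (rule bij_imp_permutes)
    show "bij_betw \<tau> {..<length x} {..<length x}"
      by (rule bij_betw_byWitness[where f' = \<tau>])
        (auto simp: S_even_involution[OF \<tau>(1)] S_even_less_iff[OF \<tau>(1)] assms(4))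
  qed (simp add: S_evenE(2)[OF \<tau>(1)] assms(4))
  \<comment> \<open>As \<open>\<tau>\<close> is an involution, this undoes it: \<open>y\<close> has
    the vertices of \<open>\<alpha>\<close> in first place and so differs from
    \<open>\<alpha>\<close> by an odd-group element only.\<close>
  define y where "y = permute_list \<tau> x"
  have "Sig y (2 * j) = Sig \<alpha> (2 * j)" if "j < k" for j
    using Sig_permute_even[OF \<tau>(1) assms(4), of "2 * j"] \<tau>(2)[OF that] mem[OF that] that
    by (auto simp: y_def)
  moreover have "distinct y" "set y = set \<alpha>" "length y = 2 * k"
    using assms perm by (simp_all add: y_def)
  ultimately obtain \<sigma> where \<sigma>: "\<sigma> \<in> S_odd k" "permute_list \<sigma> \<alpha> = y"
    using obtain_S_odd[of y \<alpha> k] assms by blast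
  have x: "permute_list \<tau> (permute_list \<sigma> \<alpha>) = x"
    using \<sigma>(2) permute_list_S_even_involution[OF \<tau>(1) assms(4)] by (simp add: y_def)
  have "facet_coeff \<alpha> x = (\<Prod>j<k. if \<tau> (2 * j) = 2 * j then 1 else -1)"
    unfolding facet_coeff_def cycle_coeff_def
  proof (intro prod.cong)
    fix j assume "j \<in> {..<k}"
    then show "of_bool (Sig x (2 * j) = Sig \<alpha> (2 * j)) -
        of_bool (Sig x (2 * j + 1) = Sig \<alpha> (2 * j))
      = (if \<tau> (2 * j) = 2 * j then 1 else - 1 :: rat)"
      using S_even_fix_iff[OF \<tau>(1) \<sigma>(1) x assms(5,1), of j] by auto
  qed (simp add: assms(4))
  also have "\<dots> = of_int (sign \<tau>)"
    unfolding S_evenE(3)[OF \<tau>(1)] of_int_prod by (intro prod.cong) auto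
  finally show ?thesis
    using True tau_eqI[OF \<tau>(1) \<sigma>(1) x assms(5,1)] by simp
next
  case False
  then obtain j where "j < k" "Sig \<alpha> (2 * j) \<notin> {Sig x (2 * j), Sig x (2 * j + 1)}"
    using phi_in_Delta_iff[of x \<alpha>] assms by auto
  then have "facet_coeff \<alpha> x = 0"
    unfolding facet_coeff_def cycle_coeff_def
    using assms(4) by (intro prod_zero) (auto intro!: bexI[of _ j])
  then show ?thesis
    using False by simp
qed

lemma facet_coeff_refl:
  assumes "distinct x" "length x = 2 * k"
  shows "facet_coeff x x = 1"
  unfolding facet_coeff_def cycle_coeff_def
proof (intro prod.neutral ballI)
  fix j assume "j \<in> {..<length x div 2}"
  then have "Sig x (2 * j) \<noteq> Sig x (2 * j + 1)"
    using Sig_even_neq_odd[OF assms(1), of j] assms(2) by auto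
  then show "of_bool (Sig x (2 * j) = Sig x (2 * j)) -
      of_bool (Sig x (2 * j + 1) = Sig x (2 * j)) = (1 :: rat)"
    by auto
qed


subsection \<open>Straightening\<close>

text \<open>
  The factors are chosen so that sorting a block and rewriting \<open>ab/cd\<close> with \<open>a < b < c < d\<close> by the
  six-term relation both decrease the level.
\<close>

fun level :: "nat \<Rightarrow> nat list \<Rightarrow> nat"
  where
    "level j (a # b # v) = (3 * j + 1) * a + 3 * j * b + level (Suc j) v"
  | "level j v = 0"

lemma level_append:
  assumes "even (length u)"
  shows "level j (u @ w) = level j u + level (j + length u div 2) w"
  using assms by (induction j u rule: level.induct) auto

lemma split_at_block:
  assumes "i + 1 < length x"
  shows "x = take i x @ [x ! i, x ! (i + 1)] @ drop (i + 2) x"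
  using assms by (simp add: Cons_nth_drop_Suc)

lemma not_alternating_cases:
  assumes "distinct x" "even (length x)" "\<not> alternating x"
  obtains (block) u a b v where "x = u @ [a, b] @ v" "even (length u)" "b < a"
    | (blocks) u a b c d v where "x = u @ [a, b, c, d] @ v" "even (length u)" "a < b" "b < c" "c < d"
proof (cases "\<exists>i. even i \<and> i + 1 < length x \<and> x ! (i + 1) < x ! i")
  case True
  then obtain i where i: "even i" "i + 1 < length x" "x ! (i + 1) < x ! i"
    by blast
  then show ?thesis
    using block[OF split_at_block[OF i(2)]] by simp
next
  case False
  have neq: "x ! i \<noteq> x ! (i + 1)" if "i + 1 < length x" for i
    using assms(1) that by (simp add: nth_eq_iff_index_eq)
  have sorted: "x ! i < x ! (i + 1)" if "even i" "i + 1 < length x" for i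
    using False neq[OF that(2)] that by (meson linorder_less_linear)
  then obtain i where i: "odd i" "i + 1 < length x" "\<not> x ! i > x ! (i + 1)"
    using assms(3) unfolding alternating_def by (metis Suc_eq_plus1)
  then obtain m where m: "i = m + 1" "even m"
    by (metis Suc_eq_plus1 even_Suc oddE dvd_triv_left)
  \<comment> \<open>The failure occurs between positions \<open>m + 1\<close> and
    \<open>m + 2\<close>; since \<open>m\<close> and the length are even, the second block is
    complete.\<close>
  have len: "m + 3 < length x"
    using i(2) m assms(2) by (auto elim!: evenE; presburger)
  show ?thesis
  proof (rule blocks)
    show "x = take m x @ [x ! m, x ! (m + 1), x ! (m + 2), x ! (m + 3)] @ drop (m + 4) x"
      using len by (simp add: Cons_nth_drop_Suc eval_nat_numeral)
    show "x ! m < x ! (m + 1)"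
      using sorted[of m] m len by simp
    show "x ! (m + 2) < x ! (m + 3)"
      using sorted[of "m + 2"] m len by (simp add: numeral_3_eq_3)
    show "x ! (m + 1) < x ! (m + 2)"
      using i(3) neq[of "m + 1"] m len by simp
  qed (use m len in simp)
qed

text \<open>Induction on the level: a list that is not alternating is, modulo a relation, a
  combination of rearrangements of strictly smaller level.\<close>

lemma basis_elt_in_span:
  assumes "x \<in> Perm I" "even (card I)"
  shows "basis_elt x \<in> Q_space.span
    (basis_elt ` Alt I \<union> (swap_relations I \<union> six_term_relations I))"
    (is "_ \<in> Q_space.span ?S")
  using assms(1)
proof (induction "level 0 x" arbitrary: x rule: less_induct)
  case less
  note IH = less.hyps[OF _ Perm_mset_eq[OF less.prems]]
  have dist: "distinct x" and len: "length x = card I"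
    using less.prems by (auto simp: permutations_of_set_def Perm_lengthD[OF less.prems])
  show ?case
  proof (cases "alternating x")
    case True
    then show ?thesis
      using less.prems by (intro Q_space.span_base) (auto simp: Alt_def)
  next
    case False
    then show ?thesis
    proof (cases rule: not_alternating_cases[OF dist _ False, case_names even block blocks])
      \<comment> \<open>This case is the parity premise of \<open>not_alternating_cases\<close> that
        was left open.\<close>
      case even
      then show ?case
        using len assms(2) by simp
    next
      case (block u a b v)
      have "basis_elt x + basis_elt (u @ [b, a] @ v) \<in> swap_relations I"
        using block less.prems unfolding swap_relations_def by blast
      then have "basis_elt x + basis_elt (u @ [b, a] @ v) \<in> Q_space.span ?S"
        by (intro Q_space.span_base) blast
      moreover have "basis_elt (u @ [b, a] @ v) \<in> Q_space.span ?S"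
        using block by (intro IH) (simp_all add: level_append)
      ultimately show ?thesis
        using Q_space.span_diff by fastforce
    next
      case (blocks u a b c d v)
      let ?r = "\<lambda>a b c d. basis_elt (u @ [a, b, c, d] @ v)"
      have "?r a b c d - ?r a c b d + ?r a d b c + ?r b c a d - ?r b d a c + ?r c d a b
        \<in> six_term_relations I"
        using blocks less.prems unfolding six_term_relations_def by blast
      then have R: "?r a b c d - ?r a c b d + ?r a d b c + ?r b c a d - ?r b d a c + ?r c d a b
        \<in> Q_space.span ?S"
        by (intro Q_space.span_base) blast
      have "?r a c b d \<in> Q_space.span ?S" "?r a d b c \<in> Q_space.span ?S"
        "?r b c a d \<in> Q_space.span ?S" "?r b d a c \<in> Q_space.span ?S"
        "?r c d a b \<in> Q_space.span ?S"
        using blocks by (intro IH; simp add: level_append algebra_simps)+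
      \<comment> \<open>Solves the six-term relation for its term of highest level.\<close>
      then have "(?r a b c d - ?r a c b d + ?r a d b c + ?r b c a d - ?r b d a c + ?r c d a b)
          + ?r a c b d - ?r a d b c - ?r b c a d + ?r b d a c - ?r c d a b \<in> Q_space.span ?S"
        by (intro Q_space.span_add Q_space.span_diff R)
      then show ?thesis
        using blocks(1) by (simp add: algebra_simps)
    qed
  qed
qed


subsection \<open>The triangular system\<close>

text \<open>The condition inside the description defining \<open>struct_const\<close>, named so that
  existence and uniqueness can be treated separately.\<close>

definition is_expansion :: "nat set \<Rightarrow> nat list \<Rightarrow> (nat list \<Rightarrow> rat) \<Rightarrow> bool"
  where "is_expansion I x c \<longleftrightarrow> (\<forall>\<beta>. \<beta> \<notin> Alt I \<longrightarrow> c \<beta> = 0) \<and>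
    basis_elt x - (\<Sum>\<beta>\<in>Alt I. scaleQ (c \<beta>) (basis_elt \<beta>)) \<in> M_Perm I"

lemma finite_Alt: "finite (Alt I)"
  by (rule finite_subset[of _ "Perm I"]) (auto simp: Alt_def)

lemma is_expansion_exists:
  assumes "x \<in> Perm I" "even (card I)"
  shows "\<exists>c. is_expansion I x c"
proof -
  have inj: "inj_on basis_elt (Alt I)"
    by (rule inj_onI) (metis basis_elt_def lookup_single_eq lookup_single_not_eq zero_neq_one)
  obtain p q where pq: "basis_elt x = p + q" "p \<in> Q_space.span (basis_elt ` Alt I)" "q \<in> M_Perm I"
    using basis_elt_in_span[OF assms] unfolding Q_space.span_Un M_Perm_def by blast
  then obtain w where w: "p = (\<Sum>v\<in>basis_elt ` Alt I. scaleQ (w v) v)"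
    unfolding Q_space.span_finite[OF finite_imageI[OF finite_Alt]] by blast
  define c where "c \<beta> = (if \<beta> \<in> Alt I then w (basis_elt \<beta>) else 0)" for \<beta>
  have "p = (\<Sum>\<beta>\<in>Alt I. scaleQ (c \<beta>) (basis_elt \<beta>))"
    unfolding w sum.reindex[OF inj] by (intro sum.cong) (auto simp: c_def)
  then have "is_expansion I x c"
    using pq unfolding is_expansion_def by (auto simp: c_def)
  then show ?thesis
    by blast
qed

lemma facet_coeff_Perm:
  assumes "even (card I)" "x \<in> Perm I" "\<alpha> \<in> Alt I"
  shows "facet_coeff \<alpha> x =
    (if x = \<alpha> then 1 else if lessdot I x \<alpha> then of_int (sign (tau \<alpha> x)) else 0)"
proof -
  have \<alpha>: "\<alpha> \<in> Perm I"
    using assms(3) by (simp add: Alt_def)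
  obtain k where k: "card I = 2 * k"
    using assms(1) by (auto elim: evenE)
  have *: "distinct x" "distinct \<alpha>" "set x = set \<alpha>" "length x = 2 * k" "length \<alpha> = 2 * k"
    using assms(2) \<alpha> Perm_lengthD[OF assms(2)] Perm_lengthD[OF \<alpha>] k
    by (auto simp: permutations_of_set_def)
  show ?thesis
    using facet_coeff_eq[OF *] facet_coeff_refl[OF *(1,4)] assms by (auto simp: lessdot_def)
qed

text \<open>The functional of the facet \<open>phi \<alpha>\<close> kills \<open>M_Perm I\<close>,
  so it takes equal values on both sides of the expansion. The diagonal coefficient is 1, which
  allows solving for \<open>c \<alpha>\<close>.\<close>

lemma is_expansion_recursion:
  assumes "even (card I)" "x \<in> Perm I" "is_expansion I x c" "\<alpha> \<in> Alt I"
  shows "c \<alpha> = (if x = \<alpha> then 1 else if lessdot I x \<alpha> then of_int (sign (tau \<alpha> x)) else 0)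
    - (\<Sum>\<beta>\<in>{\<beta> \<in> Alt I. lessdot I \<beta> \<alpha>}. of_int (sign (tau \<alpha> \<beta>)) * c \<beta>)"
proof -
  have Alt_Perm: "\<beta> \<in> Perm I" if "\<beta> \<in> Alt I" for \<beta>
    using that by (simp add: Alt_def)
  have "coeff_functional I (facet_coeff \<alpha>)
      (basis_elt x - (\<Sum>\<beta>\<in>Alt I. scaleQ (c \<beta>) (basis_elt \<beta>))) = 0"
    unfolding facet_coeff_def
    using assms(3) by (intro coeff_functional_M_Perm) (simp add: is_expansion_def)
  then have "facet_coeff \<alpha> x = (\<Sum>\<beta>\<in>Alt I. c \<beta> * facet_coeff \<alpha> \<beta>)"
    using assms(2) Alt_Perm
    by (simp add: coeff_functional_diff coeff_functional_sum coeff_functional_scaleQ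
        coeff_functional_basis_elt)
  also have "\<dots> = c \<alpha> * facet_coeff \<alpha> \<alpha> + (\<Sum>\<beta>\<in>Alt I - {\<alpha>}. c \<beta> * facet_coeff \<alpha> \<beta>)"
    using finite_Alt assms(4) by (rule sum.remove)
  also have "(\<Sum>\<beta>\<in>Alt I - {\<alpha>}. c \<beta> * facet_coeff \<alpha> \<beta>)
      = (\<Sum>\<beta>\<in>{\<beta> \<in> Alt I. lessdot I \<beta> \<alpha>}. of_int (sign (tau \<alpha> \<beta>)) * c \<beta>)"
    using finite_Alt assms(1,4) Alt_Perm
    by (intro sum.mono_neutral_cong_right) (auto simp: facet_coeff_Perm lessdot_def)
  finally show ?thesis
    using facet_coeff_Perm[OF assms(1) Alt_Perm[OF assms(4)] assms(4)]
      facet_coeff_Perm[OF assms(1,2,4)] by simp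
qed

lemma preceq_eq_or_Alt:
  assumes "preceq I x y"
  shows "x = y \<or> y \<in> Alt I"
proof -
  have "(lessdot I)\<^sup>*\<^sup>* x y"
    using assms by (simp add: preceq_def)
  then show ?thesis
    by cases (auto simp: lessdot_def)
qed

lemma preceq_refl: "x \<in> Perm I \<Longrightarrow> preceq I x x"
  by (simp add: preceq_def)

lemma preceq_step: "preceq I x \<beta> \<Longrightarrow> lessdot I \<beta> \<alpha> \<Longrightarrow> preceq I x \<alpha>"
  unfolding preceq_def by (auto simp: lessdot_def Alt_def intro: rtranclp.rtrancl_into_rtrancl)

text \<open>Both sides satisfy the same recursion, compared by induction on the measure that makes
  \<open>f_Perm\<close> terminate.\<close>

lemma is_expansion_eq_f_Perm:
  assumes "even (card I)" "x \<in> Perm I" "is_expansion I x c" "\<alpha> \<in> Alt I"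
  shows "c \<alpha> = (if preceq I x \<alpha> then of_int (f_Perm I x \<alpha>) else 0)"
  using assms(4)
proof (induction "2 * weight \<alpha> + (if alternating \<alpha> then 1 else 0)" arbitrary: \<alpha>
    rule: less_induct)
  case less
  define A where "A = {\<beta> \<in> Alt I. lessdot I \<beta> \<alpha>}"
  define h where "h \<beta> = of_int (sign (tau \<alpha> \<beta>)) * (of_int (f_Perm I x \<beta>) :: rat)" for \<beta>
  have "(\<Sum>\<beta>\<in>A. of_int (sign (tau \<alpha> \<beta>)) * c \<beta>) = (\<Sum>\<beta>\<in>A. if preceq I x \<beta> then h \<beta> else 0)"
    using less.hyps[OF lessdot_measure] by (intro sum.cong) (auto simp: A_def h_def)
  also have "\<dots> = (\<Sum>\<beta>\<in>{\<beta> \<in> A. preceq I x \<beta>}. h \<beta>)"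
    using finite_Alt by (intro sum.inter_filter[symmetric]) (simp add: A_def)
  finally have c: "c \<alpha> =
      (if x = \<alpha> then 1 else if lessdot I x \<alpha> then of_int (sign (tau \<alpha> x)) else 0)
      - (\<Sum>\<beta>\<in>{\<beta> \<in> A. preceq I x \<beta>}. h \<beta>)"
    using is_expansion_recursion[OF assms(1-3) less.prems] by (simp add: A_def)
  have no_loop: "\<not> lessdot I \<alpha> \<alpha>"
    by (simp add: lessdot_def)
  show ?case
  proof (cases "x \<in> Alt I")
    case True
    \<comment> \<open>For alternating \<open>x\<close> only \<open>\<beta> = x\<close> contributes
      to the sum, and this term cancels the sign term in \<open>c\<close>.\<close>
    then have f: "f_Perm I x \<beta> = (if \<beta> = x then 1 else 0)" for \<beta>
      by (simp add: f_Perm.simps)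
    have "(\<Sum>\<beta>\<in>{\<beta> \<in> A. preceq I x \<beta>}. h \<beta>)
        = (\<Sum>\<beta>\<in>{\<beta> \<in> A. preceq I x \<beta>}. if \<beta> = x then of_int (sign (tau \<alpha> x)) else 0)"
      by (intro sum.cong) (auto simp: h_def f)
    also have "\<dots> = (if lessdot I x \<alpha> then of_int (sign (tau \<alpha> x)) else 0)"
      using finite_Alt True preceq_refl[OF assms(2)] by (subst sum.delta) (auto simp: A_def)
    finally show ?thesis
      using c f no_loop preceq_refl[OF assms(2)] by auto
  next
    case False
    then have neq: "x \<noteq> \<alpha>"
      using less.prems by blast
    define D where "D = {\<beta>. preceq I x \<beta> \<and> lessdot I \<beta> \<alpha>}"
    \<comment> \<open>The index set of \<open>f_Perm\<close> also admits the non-alternating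
      \<open>\<beta> = x\<close>; all its other members are alternating.\<close>
    have D: "D = {\<beta> \<in> A. preceq I x \<beta>} \<union> (if lessdot I x \<alpha> then {x} else {})"
      using preceq_eq_or_Alt preceq_refl[OF assms(2)] by (auto simp: D_def A_def)
    have "(\<Sum>\<beta>\<in>D. h \<beta>) = (\<Sum>\<beta>\<in>{\<beta> \<in> A. preceq I x \<beta>}. h \<beta>) + (if lessdot I x \<alpha> then h x else 0)"
      unfolding D using False finite_Alt by (subst sum.union_disjoint) (auto simp: A_def)
    \<comment> \<open>The value -1 of \<open>f_Perm I x x\<close> turns the inhomogeneous sign term
      of the recursion into the summand at \<open>x\<close>.\<close>
    moreover have "h x = - of_int (sign (tau \<alpha> x))"
      using False by (simp add: h_def f_Perm.simps)
    ultimately have "c \<alpha> = - (\<Sum>\<beta>\<in>D. h \<beta>)"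
      using c neq by simp
    moreover have "of_int (f_Perm I x \<alpha>) = - (\<Sum>\<beta>\<in>D. h \<beta>)"
      using False neq by (subst f_Perm.simps) (simp add: D_def h_def)
    \<comment> \<open>Outside the order the sum is empty, so \<open>c \<alpha>\<close> is 0.\<close>
    moreover have "D = {}" if "\<not> preceq I x \<alpha>"
      using that preceq_step by (auto simp: D_def)
    ultimately show ?thesis
      by auto
  qed
qed

theorem theorem5p2:
  fixes n k :: nat and I :: "nat set" and x \<alpha> :: "nat list"
  assumes "I \<subseteq> {1..n + 1}" and "card I = 2 * k"
    and "x \<in> Perm I" and "\<alpha> \<in> Alt I"
  shows "struct_const I x \<alpha> = (if preceq I x \<alpha> then of_int (f_Perm I x \<alpha>) else 0)"
proof -
  have even: "even (card I)"
    using assms(2) by simp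
  obtain c where c: "is_expansion I x c"
    using is_expansion_exists[OF assms(3) even] by blast
  \<comment> \<open>Uniqueness follows from the formula itself: it determines every expansion on
    \<open>Alt I\<close>, and off \<open>Alt I\<close> all of them are 0.\<close>
  have "c' = c" if "is_expansion I x c'" for c'
  proof
    fix \<beta>
    show "c' \<beta> = c \<beta>"
      using is_expansion_eq_f_Perm[OF even assms(3) c, of \<beta>]
        is_expansion_eq_f_Perm[OF even assms(3) that, of \<beta>] c that
      by (cases "\<beta> \<in> Alt I") (auto simp: is_expansion_def)
  qed
  then have "struct_const I x = c"
    unfolding struct_const_def is_expansion_def[symmetric] using c by (intro the_equality)
  then show ?thesis
    using is_expansion_eq_f_Perm[OF even assms(3) c assms(4)] by simp
qed

end
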